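(* Let $X$ be a non-void simplicial complex with a linear order of its facets $\prec:\sigma_1\prec\cdots\prec\sigma_m$. Let $G$ be the complete graph on the vertex set $\{1,\dots,m\}$ with vertex weights $w(i)=|\sigma_i|$ for $1\le i\le m$ and edge weights $w(\{i,j\})=|\sigma_i\cap\sigma_j|$ for $1\le i<j\le m$. Then there is a spanning tree $F$ of $G$ such that \[ N_{\prec}(X)=\chi_w(F)-|V(X)|+1 . \]
   Context: A simplicial complex is a finite collection of finite sets (faces) closed under taking subsets; facets are the inclusion-maximal faces, all of which are listed in $\sigma_1,\dots,\sigma_m$. $V(X)$ is the set of vertices of $X$, i.e. the union of its facets, and $\dim\sigma=|\sigma|-1$. For $j=2,\dots,m$ let $\operatorname{conn}_\prec\sigma_j=\max\{|\sigma_i\cap\sigma_j|:i<j\}$, and define \[ N_\prec(X)=m-|V(X)|+|\sigma_1|+\sum_{j=2}^m(\dim\sigma_j-\operatorname{conn}_\prec\sigma_j). \] For a subgraph $F$ of the weighted graph $G$ (with the weights inherited from $G$), the weighted Euler characteristic is $\chi_w(F)=\sum_{v\in V(F)}w(v)-\sum_{e\in E(F)}w(e)$. *)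

theory Defs
  imports Main
begin

section \<open>Simplicial complexes and facet orderings\<close>

text \<open>Faces are sets over an arbitrary type. The void complex \<open>{}\<close> (no faces) satisfies this
  predicate and differs from \<open>{{}}\<close>, whose only facet is the empty face.\<close>

definition abstract_simplicial_complex :: "'a set set \<Rightarrow> bool" where
  "abstract_simplicial_complex X \<longleftrightarrow>
     finite X \<and> (\<forall>\<sigma>\<in>X. finite \<sigma>) \<and> (\<forall>\<sigma>\<in>X. \<forall>\<tau>. \<tau> \<subseteq> \<sigma> \<longrightarrow> \<tau> \<in> X)"

definition facets :: "'a set set \<Rightarrow> 'a set set" where
  "facets X = {\<sigma> \<in> X. \<forall>\<tau>\<in>X. \<sigma> \<subseteq> \<tau> \<longrightarrow> \<sigma> = \<tau>}"

definition complex_vertices :: "'a set set \<Rightarrow> 'a set" where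
  "complex_vertices X = \<Union>(facets X)"

definition face_dim :: "'a set \<Rightarrow> int" where
  "face_dim \<sigma> = int (card \<sigma>) - 1"

text \<open>A linear order on the finitely many facets is given by listing them in increasing order,
  without repetition, as \<open>\<sigma> 1, \<dots>, \<sigma> m\<close>; values of \<open>\<sigma>\<close> outside \<open>{1..m}\<close> are irrelevant.\<close>

definition facet_ordering :: "'a set set \<Rightarrow> nat \<Rightarrow> (nat \<Rightarrow> 'a set) \<Rightarrow> bool" where
  "facet_ordering X m \<sigma> \<longleftrightarrow> bij_betw \<sigma> {1..m} (facets X)"

text \<open>Only meaningful for \<open>j \<ge> 2\<close>; otherwise the maximum is over the empty set.\<close>

definition conn :: "(nat \<Rightarrow> 'a set) \<Rightarrow> nat \<Rightarrow> nat" where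
  "conn \<sigma> j = Max ((\<lambda>i. card (\<sigma> i \<inter> \<sigma> j)) ` {1..<j})"

definition N_prec :: "'a set set \<Rightarrow> nat \<Rightarrow> (nat \<Rightarrow> 'a set) \<Rightarrow> int" where
  "N_prec X m \<sigma> =
     int m - int (card (complex_vertices X)) + int (card (\<sigma> 1))
       + (\<Sum>j=2..m. face_dim (\<sigma> j) - int (conn \<sigma> j))"


section \<open>Weighted simple graphs and spanning trees\<close>

text \<open>Undirected edges are two-element vertex sets. The digraph library of the AFP entry
  \<open>Graph_Theory\<close> is not used: its \<open>tree\<close> only excludes directed cycles, so it accepts every
  weakly connected acyclic orientation and rejects every symmetric digraph with an arc.\<close>

record 'v ugraph =
  verts :: "'v set"
  edges :: "'v set set"

record ('v, 'w) wgraph = "'v ugraph" +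
  vweight :: "'v \<Rightarrow> 'w"
  eweight :: "'v set \<Rightarrow> 'w"

definition all_pairs :: "'v set \<Rightarrow> 'v set set" where
  "all_pairs V = {{u, v} | u v. u \<in> V \<and> v \<in> V \<and> u \<noteq> v}"

definition simple_graph :: "('v, 'x) ugraph_scheme \<Rightarrow> bool" where
  "simple_graph G \<longleftrightarrow> finite (verts G) \<and> edges G \<subseteq> all_pairs (verts G)"

definition complete_graph_on :: "'v set \<Rightarrow> ('v, 'x) ugraph_scheme \<Rightarrow> bool" where
  "complete_graph_on V G \<longleftrightarrow> verts G = V \<and> edges G = all_pairs V"

definition is_subgraph :: "('v, 'x) ugraph_scheme \<Rightarrow> ('v, 'y) ugraph_scheme \<Rightarrow> bool" where
  "is_subgraph F G \<longleftrightarrow> simple_graph F \<and> verts F \<subseteq> verts G \<and> edges F \<subseteq> edges G"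

definition connected_graph :: "('v, 'x) ugraph_scheme \<Rightarrow> bool" where
  "connected_graph G \<longleftrightarrow>
     verts G \<noteq> {} \<and> (\<forall>u\<in>verts G. \<forall>v\<in>verts G. (u, v) \<in> {(x, y). {x, y} \<in> edges G}\<^sup>*)"

text \<open>A cycle is given by the list of its distinct vertices in cyclic order.\<close>

definition is_cycle :: "('v, 'x) ugraph_scheme \<Rightarrow> 'v list \<Rightarrow> bool" where
  "is_cycle G p \<longleftrightarrow> length p \<ge> 3 \<and> distinct p \<and> set p \<subseteq> verts G \<and>
     (\<forall>i<length p. {p ! i, p ! (Suc i mod length p)} \<in> edges G)"

definition is_tree :: "('v, 'x) ugraph_scheme \<Rightarrow> bool" where
  "is_tree G \<longleftrightarrow> simple_graph G \<and> connected_graph G \<and> (\<nexists>p. is_cycle G p)"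

definition is_spanning_tree :: "('v, 'x) ugraph_scheme \<Rightarrow> ('v, 'y) ugraph_scheme \<Rightarrow> bool" where
  "is_spanning_tree F G \<longleftrightarrow> is_subgraph F G \<and> verts F = verts G \<and> is_tree F"

text \<open>\<open>F\<close> is meant to be a subgraph of \<open>G\<close> and takes its weights from \<open>G\<close>.\<close>

definition weighted_euler_char ::
  "('v, 'w::ab_group_add, 'x) wgraph_scheme \<Rightarrow> ('v, 'y) ugraph_scheme \<Rightarrow> 'w" where
  "weighted_euler_char G F = (\<Sum>v\<in>verts F. vweight G v) - (\<Sum>e\<in>edges F. eweight G e)"

end

(* For each j \<ge> 2 choose p j < j maximising |\<sigma> (p j) \<inter> \<sigma> j|. The edges {p j, j} form a spanning
   tree: every vertex descends to 1 along p, and the largest vertex of a cycle would have two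
   distinct smaller neighbours, both equal to its parent. Its edges have total weight
   \<Sum> conn j, so the identity amounts to m - (m - 1) = 1. *)

theory Submission
  imports Defs
begin

text \<open>This gives \<open>m\<close> at least 1, so that the root 1 of the tree exists.\<close>

lemma facets_nonempty:
  assumes "abstract_simplicial_complex X" and "X \<noteq> {}"
  shows "facets X \<noteq> {}"
proof -
  have "finite X"
    using assms(1) by (simp add: abstract_simplicial_complex_def)
  then obtain \<sigma> where "\<sigma> \<in> X" "\<forall>\<tau>\<in>X. \<sigma> \<subseteq> \<tau> \<longrightarrow> \<sigma> = \<tau>"
    using finite_has_maximal[of X] assms(2) by auto
  then show ?thesis
    by (auto simp: facets_def)
qed

text \<open>For \<open>j\<close> at least 2 the maximum runs over a nonempty finite set. An index
  attaining it will serve as the parent of \<open>j\<close>.\<close>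

lemma conn_attained:
  assumes "2 \<le> j"
  shows "\<exists>i\<in>{1..<j}. card (\<sigma> i \<inter> \<sigma> j) = conn \<sigma> j"
proof -
  let ?A = "(\<lambda>i. card (\<sigma> i \<inter> \<sigma> j)) ` {1..<j}"
  have "Max ?A \<in> ?A"
    using assms by (intro Max_in) auto
  then show ?thesis
    unfolding conn_def by fastforce
qed

text \<open>Vertex 1 acts as the root. Edges are indexed by the child endpoint, so that sums over
  edges become sums over \<open>{2..m}\<close>.\<close>

definition parent_graph :: "nat \<Rightarrow> (nat \<Rightarrow> nat) \<Rightarrow> nat ugraph" where
  "parent_graph m p = \<lparr>verts = {1..m}, edges = (\<lambda>j. {p j, j}) ` {2..m}\<rparr>"

locale parent_function =
  fixes m :: nat and p :: "nat \<Rightarrow> nat"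
  assumes parent: "j \<in> {2..m} \<Longrightarrow> p j \<in> {1..<j}"
begin

text \<open>Since \<open>p j < j\<close>, the larger endpoint of an edge is always the child. The
  weak inequality, whose equality case is vacuous, allows direct comparison with a maximal
  vertex.\<close>

lemma edge_to_smaller:
  assumes "{a, b} \<in> edges (parent_graph m p)" and "a \<le> b"
  shows "a = p b"
proof -
  obtain j where "j \<in> {2..m}" "{a, b} = {p j, j}"
    using assms(1) by (auto simp: parent_graph_def)
  then show ?thesis
    using parent[of j] assms(2) by (auto simp: doubleton_eq_iff)
qed

lemma simple_parent_graph: "simple_graph (parent_graph m p)"
proof -
  have "{p j, j} \<in> all_pairs {1..m}" if "j \<in> {2..m}" for j
    unfolding all_pairs_def using parent[OF that] that by fastforce
  then show ?thesis
    by (auto simp: simple_graph_def parent_graph_def)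
qed

lemma connected_parent_graph:
  assumes "1 \<le> m"
  shows "connected_graph (parent_graph m p)"
proof -
  let ?E = "{(x, y). {x, y} \<in> edges (parent_graph m p)}"
  have "sym ?E"
    by (auto simp: sym_def insert_commute)
  then have sym: "sym (?E\<^sup>*)"
    by (rule sym_rtrancl)
  \<comment> \<open>Strong induction: \<open>p v < v\<close>, so repeated passage to the parent ends
    at 1.\<close>
  have root: "(v, 1) \<in> ?E\<^sup>*" if "v \<in> {1..m}" for v
    using that
  proof (induction v rule: less_induct)
    case (less v)
    show ?case
    proof (cases "v = 1")
      case False
      then have v: "v \<in> {2..m}"
        using less.prems by auto
      then have "(v, p v) \<in> ?E"
        by (auto simp: parent_graph_def insert_commute)
      moreover have "(p v, 1) \<in> ?E\<^sup>*"
        using less.IH[of "p v"] parent[OF v] v by auto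
      ultimately show ?thesis
        by (rule converse_rtrancl_into_rtrancl)
    qed simp
  qed
  \<comment> \<open>Go from \<open>u\<close> down to the root, then along the reversed path up to
    \<open>v\<close>.\<close>
  have "(u, v) \<in> ?E\<^sup>*" if "u \<in> {1..m}" "v \<in> {1..m}" for u v
    using root[OF that(1)] symD[OF sym root[OF that(2)]] by (rule rtrancl_trans)
  then show ?thesis
    using assms by (auto simp: connected_graph_def parent_graph_def)
qed

lemma acyclic_parent_graph: "\<not> is_cycle (parent_graph m p) c"
proof
  assume cycle: "is_cycle (parent_graph m p) c"
  define n where "n = length c"
  have n: "3 \<le> n" and "distinct c"
    and edge: "\<And>i. i < n \<Longrightarrow> {c ! i, c ! (Suc i mod n)} \<in> edges (parent_graph m p)"
    using cycle by (auto simp: is_cycle_def n_def)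
  have "Max (set c) \<in> set c"
    using n by (intro Max_in) (auto simp: n_def)
  then obtain k where k: "k < n" "c ! k = Max (set c)"
    by (auto simp: in_set_conv_nth n_def)
  have le: "c ! i \<le> c ! k" if "i < n" for i
    using that k(2) by (simp add: n_def)
  \<comment> \<open>\<open>s\<close> and \<open>r\<close> are the cyclic successor and predecessor
    of the position \<open>k\<close> of the largest vertex; they differ because the cycle has length
    at least 3.\<close>
  define s where "s = Suc k mod n"
  define r where "r = (if k = 0 then n - 1 else k - 1)"
  have rs: "s < n" "r < n" "r \<noteq> s" "Suc r mod n = k"
    using n k(1) by (auto simp: r_def s_def mod_Suc)
  have "c ! s = p (c ! k)"
    using edge[OF k(1)] le[OF rs(1)]
    by (intro edge_to_smaller) (simp_all add: s_def insert_commute)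
  \<comment> \<open>The cycle edge at position \<open>r\<close> leads to position \<open>k\<close>,
    as \<open>Suc r mod n = k\<close>.\<close>
  moreover have "c ! r = p (c ! k)"
    using edge[OF rs(2)] le[OF rs(2)] rs(4) by (intro edge_to_smaller) simp_all
  ultimately show False
    using rs(1-3) nth_eq_iff_index_eq[OF \<open>distinct c\<close>, of r s] by (simp add: n_def)
qed

lemma parent_graph_is_tree: "1 \<le> m \<Longrightarrow> is_tree (parent_graph m p)"
  by (simp add: is_tree_def simple_parent_graph connected_parent_graph acyclic_parent_graph)

lemma parent_graph_spanning_tree:
  assumes "1 \<le> m" and "complete_graph_on {1..m} G"
  shows "is_spanning_tree (parent_graph m p) G"
proof -
  have "verts (parent_graph m p) = verts G"
    using assms(2) by (simp add: complete_graph_on_def parent_graph_def)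
  moreover have "edges (parent_graph m p) \<subseteq> edges G"
    using assms(2) simple_parent_graph
    by (simp add: complete_graph_on_def simple_graph_def parent_graph_def)
  ultimately show ?thesis
    using simple_parent_graph parent_graph_is_tree[OF assms(1)]
    by (simp add: is_spanning_tree_def is_subgraph_def)
qed

text \<open>An edge determines its child as its larger endpoint, so no edge is counted
  twice.\<close>

lemma sum_edges_parent_graph:
  "(\<Sum>e\<in>edges (parent_graph m p). f e) = (\<Sum>j=2..m. f {p j, j})"
proof -
  have "inj_on (\<lambda>j. {p j, j}) {2..m}"
  proof (rule inj_onI)
    fix i j
    assume "i \<in> {2..m}" "j \<in> {2..m}" "{p i, i} = {p j, j}"
    then show "i = j"
      using parent[of i] parent[of j] by (auto simp: doubleton_eq_iff)
  qed
  then show ?thesis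
    by (simp add: parent_graph_def sum.reindex)
qed

end

theorem corollary5p4:
  fixes X :: "'a set set" and m :: nat and \<sigma> :: "nat \<Rightarrow> 'a set"
    and G :: "(nat, int) wgraph"
  assumes "abstract_simplicial_complex X" and "X \<noteq> {}"
    and "facet_ordering X m \<sigma>"
    and "complete_graph_on {1..m} G"
    and "\<And>i. 1 \<le> i \<Longrightarrow> i \<le> m \<Longrightarrow> vweight G i = int (card (\<sigma> i))"
    and "\<And>i j. 1 \<le> i \<Longrightarrow> i < j \<Longrightarrow> j \<le> m \<Longrightarrow> eweight G {i, j} = int (card (\<sigma> i \<inter> \<sigma> j))"
  shows "\<exists>F :: nat ugraph. is_spanning_tree F G \<and>
    N_prec X m \<sigma> = weighted_euler_char G F - int (card (complex_vertices X)) + 1"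
proof -
  have "{1..m} \<noteq> {}"
    using assms(3) facets_nonempty[OF assms(1,2)]
    by (metis bij_betw_imp_surj_on facet_ordering_def image_empty)
  then have m: "1 \<le> m"
    by simp
  obtain p where p: "p j \<in> {1..<j}" "card (\<sigma> (p j) \<inter> \<sigma> j) = conn \<sigma> j" if "2 \<le> j" for j
    using conn_attained[of _ \<sigma>] by metis
  interpret parent_function m p
    by standard (use p(1) in auto)
  let ?F = "parent_graph m p"
  have "(\<Sum>v\<in>verts ?F. vweight G v) = (\<Sum>j=1..m. int (card (\<sigma> j)))"
    using assms(5) by (simp add: parent_graph_def)
  \<comment> \<open>The root is split off to match the separate term for the first facet in
    \<open>N_prec\<close>.\<close>
  also have "\<dots> = int (card (\<sigma> 1)) + (\<Sum>j=2..m. int (card (\<sigma> j)))"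
    using m by (simp add: sum.atLeast_Suc_atMost numeral_2_eq_2)
  finally have vertices: "(\<Sum>v\<in>verts ?F. vweight G v) =
      int (card (\<sigma> 1)) + (\<Sum>j=2..m. int (card (\<sigma> j)))" .
  have "eweight G {p j, j} = int (conn \<sigma> j)" if "j \<in> {2..m}" for j
    using assms(6)[of "p j" j] p[of j] that by simp
  then have "(\<Sum>e\<in>edges ?F. eweight G e) = (\<Sum>j=2..m. int (conn \<sigma> j))"
    by (simp add: sum_edges_parent_graph)
  \<comment> \<open>Each \<open>face_dim\<close> contributes a -1, in total \<open>-(m - 1)\<close>;
    here \<open>1 \<le> m\<close> keeps the natural subtraction exact.\<close>
  then have "N_prec X m \<sigma> = weighted_euler_char G ?F - int (card (complex_vertices X)) + 1"
    using vertices m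
    by (simp add: N_prec_def weighted_euler_char_def face_dim_def sum_subtractf of_nat_diff)
  then show ?thesis
    using parent_graph_spanning_tree[OF m assms(4)] by blast
qed

end
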